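(* Let $\mathcal P$ be a topological invariant which is $\Sigma^0_2$ in the product of upper Vietoris topologies on $\mathcal K(Q)^2$. Every $\mathcal P$-minimal pair has strong computable type.
   Context: $Q=[0,1]^{\mathbb N}$ is the Hilbert cube with metric $d_Q(x,y)=\sum_i2^{-i}|x_i-y_i|$ and rational open balls centered at rational points with finitely many nonzero coordinates. A pair $(X,A)$ is a compact metrizable space $X$ with compact $A\subseteq X$; a copy of it in $Q$ is $(Y,B)$ with $Y\subseteq Q$ and a homeomorphism $X\to Y$ sending $A$ onto $B$. A compact $K\subseteq Q$ is semicomputable relative to an oracle $O$ if the set of finite lists of rational balls whose union contains $K$ is c.e. relative to $O$; computable relative to $O$ if moreover the set of rational balls meeting $K$ is c.e. relative to $O$. $(X,A)$ has strong computable type if for every oracle $O$ and every copy $(Y,B)$ in $Q$ with $Y,B$ semicomputable relative to $O$, $Y$ is computable relative to $O$. $\mathcal K(Q)$ is the set of compact subsets of $Q$; its upper Vietoris topology has basis $\{K:K\subseteq U\}$, $U$ ranging over finite unions of rational balls (effectively numbered); we use the product topology on $\mathcal K(Q)^2$. A set is $\Sigma^0_1$ if it is a union of a c.e. family of basic open sets, $\Pi^0_1$ if its complement is $\Sigma^0_1$, and $\Sigma^0_2$ if it equals $\bigcup_n(\mathcal A_n\setminus\mathcal B_n)$ with $\mathcal A_n,\mathcal B_n$ uniformly $\Pi^0_1$. A property of pairs is a subset $\mathcal P\subseteq\mathcal K(Q)^2$; it is a topological invariant if it contains every copy in $Q$ of each of its elements. $(X',A')$ is a proper subpair of $(X,A)$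 if $X'\subsetneq X$, $A'\subseteq A$. A pair in $Q$ is $\mathcal P$-minimal if it belongs to $\mathcal P$ and none of its proper subpairs does. *)

theory Defs
  imports "HOL-Analysis.Analysis" "HOL-Library.Nat_Bijection"
begin

section \<open>Computability relative to an oracle\<close>

text \<open>\<open>recursive Or n f\<close>: the \<open>n\<close>-ary total function \<open>f\<close> is general recursive relative to the
  oracle \<open>Or\<close>. Minimization is applied only to regular functions (the search always succeeds), so
  that all functions are total. An \<open>n\<close>-ary function is represented by a function on
  lists of which only the values on lists of length \<open>n\<close> matter.\<close>

inductive recursive :: "nat set \<Rightarrow> nat \<Rightarrow> (nat list \<Rightarrow> nat) \<Rightarrow> bool" for Or :: "nat set" where
  zero: "recursive Or n (\<lambda>xs. 0)"
| succ: "recursive Or 1 (\<lambda>xs. Suc (hd xs))"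
| orac: "recursive Or 1 (\<lambda>xs. if hd xs \<in> Or then 1 else 0)"
| proj: "i < n \<Longrightarrow> recursive Or n (\<lambda>xs. xs ! i)"
| comp: "recursive Or (length fs) g \<Longrightarrow> (\<And>f. f \<in> set fs \<Longrightarrow> recursive Or n f) \<Longrightarrow>
    recursive Or n (\<lambda>xs. g (map (\<lambda>f. f xs) fs))"
| prim: "recursive Or n f \<Longrightarrow> recursive Or (Suc (Suc n)) g \<Longrightarrow>
    recursive Or (Suc n) (\<lambda>xs. rec_nat (f (tl xs)) (\<lambda>k r. g (k # r # tl xs)) (hd xs))"
| mini: "recursive Or (Suc n) f \<Longrightarrow> (\<And>xs. length xs = n \<Longrightarrow> \<exists>k. f (k # xs) = 0) \<Longrightarrow>
    recursive Or n (\<lambda>xs. LEAST k. f (k # xs) = 0)"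

definition computable_fun :: "nat set \<Rightarrow> (nat \<Rightarrow> nat) \<Rightarrow> bool" where
  "computable_fun Or f \<longleftrightarrow> (\<exists>g. recursive Or 1 g \<and> (\<forall>x. f x = g [x]))"

definition ce_in :: "nat set \<Rightarrow> nat set \<Rightarrow> bool" where
  "ce_in Or S \<longleftrightarrow> S = {} \<or> (\<exists>f. computable_fun Or f \<and> S = range f)"

abbreviation ce :: "nat set \<Rightarrow> bool" where
  "ce \<equiv> ce_in {}"

section \<open>The Hilbert cube\<close>

definition hcube :: "(nat \<Rightarrow> real) set" where
  "hcube = {x. \<forall>i. 0 \<le> x i \<and> x i \<le> 1}"

text \<open>The value 0 off the cube is irrelevant; it is there because the locale \<open>Metric_space\<close> asks for
  a distance which is nonnegative and symmetric on the whole type.\<close>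

definition dQ :: "(nat \<Rightarrow> real) \<Rightarrow> (nat \<Rightarrow> real) \<Rightarrow> real" where
  "dQ x y = (if x \<in> hcube \<and> y \<in> hcube then \<Sum>i. (1/2) ^ i * \<bar>x i - y i\<bar> else 0)"

lemma dQ_summable:
  assumes "x \<in> hcube" "y \<in> hcube"
  shows "summable (\<lambda>i. (1/2) ^ i * \<bar>x i - y i\<bar>)"
proof (rule summable_comparison_test')
  show "summable (\<lambda>i. (1/2::real) ^ i)" by (simp add: summable_geometric)
  show "norm ((1/2) ^ i * \<bar>x i - y i\<bar>) \<le> (1/2) ^ i" if "0 \<le> i" for i
  proof -
    have "0 \<le> x i" "x i \<le> 1" "0 \<le> y i" "y i \<le> 1" using assms by (auto simp: hcube_def)
    then have "\<bar>x i - y i\<bar> \<le> 1" by linarith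
    then show ?thesis by (simp add: abs_mult mult_left_le)
  qed
qed

interpretation hcube: Metric_space hcube dQ
proof
  fix x y z :: "nat \<Rightarrow> real"
  show "0 \<le> dQ x y"
    by (simp add: dQ_def suminf_nonneg dQ_summable)
  show "dQ x y = dQ y x"
    by (simp add: dQ_def abs_minus_commute)
  show "dQ x y = 0 \<longleftrightarrow> x = y" if "x \<in> hcube" "y \<in> hcube"
    using that by (auto simp: dQ_def suminf_eq_zero_iff dQ_summable)
  show "dQ x z \<le> dQ x y + dQ y z" if "x \<in> hcube" "y \<in> hcube" "z \<in> hcube"
  proof -
    have "(\<Sum>i. (1/2) ^ i * \<bar>x i - z i\<bar>)
        \<le> (\<Sum>i. (1/2) ^ i * \<bar>x i - y i\<bar> + (1/2) ^ i * \<bar>y i - z i\<bar>)"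
    proof (rule suminf_le)
      fix i
      have "\<bar>x i - z i\<bar> \<le> \<bar>x i - y i\<bar> + \<bar>y i - z i\<bar>" by linarith
      then have "(1/2) ^ i * \<bar>x i - z i\<bar> \<le> (1/2) ^ i * (\<bar>x i - y i\<bar> + \<bar>y i - z i\<bar>)"
        by (intro mult_left_mono) auto
      then show "(1/2) ^ i * \<bar>x i - z i\<bar> \<le> (1/2) ^ i * \<bar>x i - y i\<bar> + (1/2) ^ i * \<bar>y i - z i\<bar>"
        by (simp add: distrib_left)
    qed (use that in \<open>auto intro: dQ_summable summable_add\<close>)
    also have "\<dots> = (\<Sum>i. (1/2) ^ i * \<bar>x i - y i\<bar>) + (\<Sum>i. (1/2) ^ i * \<bar>y i - z i\<bar>)"
      using that by (intro suminf_add[symmetric] dQ_summable)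
    finally show ?thesis using that by (simp add: dQ_def)
  qed
qed

abbreviation Q_top :: "(nat \<Rightarrow> real) topology" where
  "Q_top \<equiv> hcube.mtopology"

section \<open>Rational balls and their numbering\<close>

definition unit_rat :: "nat \<Rightarrow> real" where
  "unit_rat n = (case prod_decode n of (a, b) \<Rightarrow> min 1 (real a / real (Suc b)))"

definition pos_rat :: "nat \<Rightarrow> real" where
  "pos_rat n = (case prod_decode n of (a, b) \<Rightarrow> real (Suc a) / real (Suc b))"

definition rat_point :: "nat \<Rightarrow> nat \<Rightarrow> real" where
  "rat_point n i = (if i < length (list_decode n) then unit_rat (list_decode n ! i) else 0)"

definition rat_ball :: "nat \<Rightarrow> (nat \<Rightarrow> real) set" where
  "rat_ball n = (case prod_decode n of (c, r) \<Rightarrow> hcube.mball (rat_point c) (pos_rat r))"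

definition rat_union :: "nat \<Rightarrow> (nat \<Rightarrow> real) set" where
  "rat_union n = (\<Union>b \<in> set (list_decode n). rat_ball b)"

text \<open>The numbering reaches exactly the open balls with positive rational radius centered at rational
  points with finitely many nonzero coordinates.\<close>

lemma range_unit_rat: "range unit_rat = {q \<in> \<rat>. 0 \<le> q \<and> q \<le> 1}"
proof (intro equalityI subsetI)
  fix q :: real assume "q \<in> range unit_rat"
  then obtain n where n: "q = unit_rat n" by blast
  obtain a b where "prod_decode n = (a, b)" by fastforce
  then have "q = min 1 (real a / real (Suc b))" by (simp add: n unit_rat_def)
  then show "q \<in> {q \<in> \<rat>. 0 \<le> q \<and> q \<le> 1}" by (auto simp: min_def)
next
  fix q :: real assume "q \<in> {q \<in> \<rat>. 0 \<le> q \<and> q \<le> 1}"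
  then have q: "q \<in> \<rat>" "0 \<le> q" "q \<le> 1" by auto
  then obtain m k where mk: "k \<noteq> 0" "\<bar>q\<bar> = real m / real k" by (auto elim: Rats_abs_nat_div_natE)
  have "unit_rat (prod_encode (m, k - 1)) = q" using mk q by (simp add: unit_rat_def)
  then show "q \<in> range unit_rat" by (metis rangeI)
qed

lemma range_pos_rat: "range pos_rat = {q \<in> \<rat>. 0 < q}"
proof (intro equalityI subsetI)
  fix q :: real assume "q \<in> range pos_rat"
  then obtain n where n: "q = pos_rat n" by blast
  obtain a b where "prod_decode n = (a, b)" by fastforce
  then have "q = real (Suc a) / real (Suc b)" by (simp add: n pos_rat_def)
  moreover have "0 < real (Suc a) / real (Suc b)" by simp
  moreover have "real (Suc a) / real (Suc b) \<in> \<rat>" by (intro Rats_divide Rats_of_nat)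
  ultimately show "q \<in> {q \<in> \<rat>. 0 < q}" by simp
next
  fix q :: real assume "q \<in> {q \<in> \<rat>. 0 < q}"
  then have q: "q \<in> \<rat>" "0 < q" by auto
  then obtain m k where mk: "k \<noteq> 0" "\<bar>q\<bar> = real m / real k" by (auto elim: Rats_abs_nat_div_natE)
  then have "m \<noteq> 0" using q by (cases "m = 0") auto
  then have "pos_rat (prod_encode (m - 1, k - 1)) = q" using mk q by (simp add: pos_rat_def)
  then show "q \<in> range pos_rat" by (metis rangeI)
qed

lemma range_rat_point:
  "range rat_point = {x \<in> hcube. (\<forall>i. x i \<in> \<rat>) \<and> finite {i. x i \<noteq> 0}}"
proof (intro equalityI subsetI)
  have u: "unit_rat k \<in> \<rat> \<and> 0 \<le> unit_rat k \<and> unit_rat k \<le> 1" for k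
    using range_unit_rat by blast
  fix x assume "x \<in> range rat_point"
  then obtain n where n: "x = rat_point n" by blast
  have "{i. x i \<noteq> 0} \<subseteq> {..<length (list_decode n)}" by (auto simp: n rat_point_def)
  then have "finite {i. x i \<noteq> 0}" by (rule finite_subset) simp
  then show "x \<in> {x \<in> hcube. (\<forall>i. x i \<in> \<rat>) \<and> finite {i. x i \<noteq> 0}}"
    using u by (auto simp: n rat_point_def hcube_def)
next
  fix x :: "nat \<Rightarrow> real"
  assume "x \<in> {x \<in> hcube. (\<forall>i. x i \<in> \<rat>) \<and> finite {i. x i \<noteq> 0}}"
  then have x: "x \<in> hcube" "\<And>i. x i \<in> \<rat>" and fin: "finite {i. x i \<noteq> 0}" by auto
  have "\<exists>k. unit_rat k = x i" for i
  proof -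
    have "x i \<in> range unit_rat" using x by (simp add: range_unit_rat hcube_def)
    then show ?thesis by auto
  qed
  then obtain c where c: "\<And>i. unit_rat (c i) = x i" by metis
  obtain N where N: "\<And>i. x i \<noteq> 0 \<Longrightarrow> i < N"
    using fin by (auto simp: finite_nat_set_iff_bounded)
  have "rat_point (list_encode (map c [0..<N])) = x"
    using N by (auto simp: rat_point_def c fun_eq_iff)
  then show "x \<in> range rat_point" by (metis rangeI)
qed

lemma range_rat_ball:
  "range rat_ball = {hcube.mball c r |c r.
     c \<in> hcube \<and> (\<forall>i. c i \<in> \<rat>) \<and> finite {i. c i \<noteq> 0} \<and> r \<in> \<rat> \<and> 0 < r}"
    (is "_ = ?R")
proof -
  have "range rat_ball = {hcube.mball c r |c r. c \<in> range rat_point \<and> r \<in> range pos_rat}"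
  proof (intro equalityI subsetI)
    fix U assume "U \<in> range rat_ball"
    then show "U \<in> {hcube.mball c r |c r. c \<in> range rat_point \<and> r \<in> range pos_rat}"
      by (clarsimp simp: rat_ball_def split: prod.splits) blast
  next
    fix U assume "U \<in> {hcube.mball c r |c r. c \<in> range rat_point \<and> r \<in> range pos_rat}"
    then obtain m k where "U = hcube.mball (rat_point m) (pos_rat k)" by blast
    then have "U = rat_ball (prod_encode (m, k))" by (simp add: rat_ball_def)
    then show "U \<in> range rat_ball" by blast
  qed
  also have "\<dots> = ?R" unfolding range_rat_point range_pos_rat by blast
  finally show ?thesis .
qed

section \<open>Semicomputable and computable compact sets\<close>

definition KQ :: "(nat \<Rightarrow> real) set set" where
  "KQ = {K. compactin Q_top K}"

definition semicomputable_in :: "nat set \<Rightarrow> (nat \<Rightarrow> real) set \<Rightarrow> bool" where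
  "semicomputable_in Or K \<longleftrightarrow> K \<in> KQ \<and> ce_in Or {l. K \<subseteq> rat_union l}"

definition computable_in :: "nat set \<Rightarrow> (nat \<Rightarrow> real) set \<Rightarrow> bool" where
  "computable_in Or K \<longleftrightarrow> semicomputable_in Or K \<and> ce_in Or {n. rat_ball n \<inter> K \<noteq> {}}"

section \<open>Pairs, copies and strong computable type\<close>

definition compact_pair :: "'a topology \<Rightarrow> 'a set \<Rightarrow> bool" where
  "compact_pair X A \<longleftrightarrow> compact_space X \<and> metrizable_space X \<and> compactin X A"

definition copy_in_Q ::
  "'a topology \<Rightarrow> 'a set \<Rightarrow> (nat \<Rightarrow> real) set \<Rightarrow> (nat \<Rightarrow> real) set \<Rightarrow> bool" where
  "copy_in_Q X A Y B \<longleftrightarrow>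
     Y \<subseteq> hcube \<and> (\<exists>h. homeomorphic_map X (subtopology Q_top Y) h \<and> h ` A = B)"

definition strong_computable_type :: "'a topology \<Rightarrow> 'a set \<Rightarrow> bool" where
  "strong_computable_type X A \<longleftrightarrow> compact_pair X A \<and>
     (\<forall>Or Y B. copy_in_Q X A Y B \<longrightarrow> semicomputable_in Or Y \<longrightarrow> semicomputable_in Or B \<longrightarrow>
        computable_in Or Y)"

section \<open>Effective complexity in the product of upper Vietoris topologies\<close>

type_synonym qset = "(nat \<Rightarrow> real) set"

definition basic_open :: "nat \<Rightarrow> nat \<Rightarrow> (qset \<times> qset) set" where
  "basic_open u v = {(K, L) \<in> KQ \<times> KQ. K \<subseteq> rat_union u \<and> L \<subseteq> rat_union v}"

definition uniformly_Sigma01 :: "(nat \<Rightarrow> (qset \<times> qset) set) \<Rightarrow> bool" where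
  "uniformly_Sigma01 S \<longleftrightarrow> (\<exists>E. ce E \<and>
     (\<forall>n. S n = (\<Union>(u, v) \<in> {(u, v). prod_encode (n, prod_encode (u, v)) \<in> E}. basic_open u v)))"

definition uniformly_Pi01 :: "(nat \<Rightarrow> (qset \<times> qset) set) \<Rightarrow> bool" where
  "uniformly_Pi01 S \<longleftrightarrow>
     (\<forall>n. S n \<subseteq> KQ \<times> KQ) \<and> uniformly_Sigma01 (\<lambda>n. KQ \<times> KQ - S n)"

definition Sigma02 :: "(qset \<times> qset) set \<Rightarrow> bool" where
  "Sigma02 P \<longleftrightarrow> (\<exists>\<A> \<B>. uniformly_Pi01 \<A> \<and> uniformly_Pi01 \<B> \<and> P = (\<Union>n. \<A> n - \<B> n))"

section \<open>Properties of pairs and minimality\<close>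

definition pair_in_Q :: "qset \<Rightarrow> qset \<Rightarrow> bool" where
  "pair_in_Q X A \<longleftrightarrow> X \<in> KQ \<and> A \<in> KQ \<and> A \<subseteq> X"

text \<open>A property is any subset of \<open>KQ \<times> KQ\<close>; it may contain elements \<open>(X, A)\<close> with
  \<open>\<not> A \<subseteq> X\<close>, which are not pairs, have no copies, and hence are subject to no condition.\<close>

definition topological_invariant :: "(qset \<times> qset) set \<Rightarrow> bool" where
  "topological_invariant P \<longleftrightarrow> P \<subseteq> KQ \<times> KQ \<and>
     (\<forall>X A Y B. (X, A) \<in> P \<longrightarrow> pair_in_Q X A \<longrightarrow> copy_in_Q (subtopology Q_top X) A Y B \<longrightarrow>
        (Y, B) \<in> P)"

definition proper_subpair :: "qset \<Rightarrow> qset \<Rightarrow> qset \<Rightarrow> qset \<Rightarrow> bool" where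
  "proper_subpair X' A' X A \<longleftrightarrow> pair_in_Q X' A' \<and> X' \<subset> X \<and> A' \<subseteq> A"

definition minimal_pair :: "(qset \<times> qset) set \<Rightarrow> qset \<Rightarrow> qset \<Rightarrow> bool" where
  "minimal_pair P X A \<longleftrightarrow> pair_in_Q X A \<and> (X, A) \<in> P \<and>
     (\<forall>X' A'. proper_subpair X' A' X A \<longrightarrow> (X', A') \<notin> P)"

end

theory Submission
  imports Defs
begin

text \<open>Let \<open>(Y, B)\<close> be a semicomputable copy of the pair. By invariance it is \<open>P\<close>-minimal, and it lies in
  some \<open>\<A> n - \<B> n\<close>. Being outside \<open>\<B> n\<close> is witnessed by one basic open set, which then contains all
  subpairs of \<open>(Y, B)\<close>; so by minimality every proper subpair is outside \<open>\<A> n\<close>. Hence a ball \<open>U\<close> meets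
  \<open>Y\<close> iff \<open>(Y - U, B - U)\<close> is outside \<open>\<A> n\<close>, iff some enumerated basic open set given by \<open>V, W\<close>
  satisfies \<open>Y \<subseteq> V \<union> U\<close> and \<open>B \<subseteq> W \<union> U\<close>, and the latter is c.e. by semicomputability.\<close>

section \<open>Recursive functions and c.e. sets\<close>

text \<open>\<open>recursive\<close> also fixes the junk values on lists of the wrong length; this variant ignores them.\<close>

definition recursive_on :: "nat set \<Rightarrow> nat \<Rightarrow> (nat list \<Rightarrow> nat) \<Rightarrow> bool" where
  "recursive_on Or n F \<longleftrightarrow> (\<exists>g. recursive Or n g \<and> (\<forall>xs. length xs = n \<longrightarrow> F xs = g xs))"

lemma recursive_onI: "recursive Or n F \<Longrightarrow> recursive_on Or n F"
  by (auto simp: recursive_on_def)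

lemma recursive_on_cong:
  assumes "recursive_on Or n F" "\<And>xs. length xs = n \<Longrightarrow> F xs = G xs"
  shows "recursive_on Or n G"
  using assms unfolding recursive_on_def by metis

text \<open>Reduces computability of a unary function to the closure rules for
  \<open>recursive_on\<close>: a list of length 1 is determined by its entry.\<close>

lemma computable_fun_iff: "computable_fun Or f \<longleftrightarrow> recursive_on Or 1 (\<lambda>xs. f (xs ! 0))"
proof
  assume "computable_fun Or f"
  then obtain g where "recursive Or 1 g" "\<And>x. f x = g [x]" by (auto simp: computable_fun_def)
  then show "recursive_on Or 1 (\<lambda>xs. f (xs ! 0))"
    unfolding recursive_on_def by (intro exI[of _ g]) (auto simp: length_Suc_conv)
next
  assume "recursive_on Or 1 (\<lambda>xs. f (xs ! 0))"
  then obtain g where g: "recursive Or 1 g" "\<And>xs. length xs = 1 \<Longrightarrow> f (xs ! 0) = g xs"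
    by (auto simp: recursive_on_def)
  have "f x = g [x]" for x using g(2)[of "[x]"] by simp
  with g(1) show "computable_fun Or f" by (auto simp: computable_fun_def)
qed

section \<open>Substitution, primitive recursion and minimization\<close>

lemma recursive_on_proj: "i < n \<Longrightarrow> recursive_on Or n (\<lambda>xs. xs ! i)"
  by (intro recursive_onI recursive.proj)

lemma recursive_on_comp:
  assumes "recursive_on Or (length Fs) G" "\<And>F. F \<in> set Fs \<Longrightarrow> recursive_on Or n F"
  shows "recursive_on Or n (\<lambda>xs. G (map (\<lambda>F. F xs) Fs))"
proof -
  obtain g where g: "recursive Or (length Fs) g" "\<And>xs. length xs = length Fs \<Longrightarrow> G xs = g xs"
    using assms(1) by (auto simp: recursive_on_def)
  obtain r where r: "\<And>F. F \<in> set Fs \<Longrightarrow> recursive Or n (r F)"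
      "\<And>F xs. F \<in> set Fs \<Longrightarrow> length xs = n \<Longrightarrow> F xs = r F xs"
    using assms(2) unfolding recursive_on_def by metis
  have "recursive Or n (\<lambda>xs. g (map (\<lambda>f. f xs) (map r Fs)))"
    using g(1) r(1) by (intro recursive.comp) auto
  moreover have "G (map (\<lambda>F. F xs) Fs) = g (map (\<lambda>f. f xs) (map r Fs))" if "length xs = n" for xs
  proof -
    have "map (\<lambda>F. F xs) Fs = map (\<lambda>f. f xs) (map r Fs)" using r(2) that by simp
    then show ?thesis using g(2) by (metis length_map)
  qed
  ultimately show ?thesis unfolding recursive_on_def by blast
qed

lemma recursive_on_computable:
  assumes "computable_fun Or f" "recursive_on Or n F"
  shows "recursive_on Or n (\<lambda>xs. f (F xs))"
  using recursive_on_comp[of Or "[F]" "\<lambda>xs. f (xs ! 0)" n] assms by (simp add: computable_fun_iff)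

text \<open>Weakening by dummy arguments, obtained by substituting projections. It is needed where
  the step of a recursion must ignore its counter and its previous value.\<close>

lemma recursive_on_drop:
  assumes "recursive_on Or n F"
  shows "recursive_on Or (m + n) (\<lambda>xs. F (drop m xs))"
proof -
  let ?Fs = "map (\<lambda>i xs. xs ! (m + i)) [0..<n]"
  have "recursive_on Or (m + n) (\<lambda>xs. F (map (\<lambda>f. f xs) ?Fs))"
    using assms by (intro recursive_on_comp) (auto intro!: recursive_on_proj)
  then show ?thesis
  proof (rule recursive_on_cong)
    fix xs :: "nat list" assume "length xs = m + n"
    then have "map (\<lambda>f. f xs) ?Fs = drop m xs" by (auto intro!: nth_equalityI)
    then show "F (map (\<lambda>f. f xs) ?Fs) = F (drop m xs)" by simp
  qed
qed

lemma recursive_on_Suc: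
  assumes "recursive_on Or n F"
  shows "recursive_on Or n (\<lambda>xs. Suc (F xs))"
  using recursive_on_comp[of Or "[F]" "\<lambda>xs. Suc (hd xs)" n] assms
    recursive_onI[OF recursive.succ] by simp

lemma recursive_on_const: "recursive_on Or n (\<lambda>_. c)"
  by (induction c) (auto intro: recursive_onI recursive.zero recursive_on_Suc)

text \<open>The constructor \<open>recursive.prim\<close> recurses on the head of its argument list.
  Feeding it \<open>H xs # xs\<close> allows an arbitrary recursive bound and keeps all of
  \<open>xs\<close> as parameters.\<close>

lemma recursive_on_rec_nat:
  assumes F: "recursive_on Or n F" and G: "recursive_on Or (Suc (Suc n)) G" and H: "recursive_on Or n H"
  shows "recursive_on Or n (\<lambda>xs. rec_nat (F xs) (\<lambda>k r. G (k # r # xs)) (H xs))"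
proof -
  obtain f where f: "recursive Or n f" "\<And>xs. length xs = n \<Longrightarrow> F xs = f xs"
    using F by (auto simp: recursive_on_def)
  obtain g where g: "recursive Or (Suc (Suc n)) g" "\<And>xs. length xs = Suc (Suc n) \<Longrightarrow> G xs = g xs"
    using G by (auto simp: recursive_on_def)
  let ?p = "\<lambda>xs. rec_nat (f (tl xs)) (\<lambda>k r. g (k # r # tl xs)) (hd xs)"
  let ?Fs = "H # map (\<lambda>i xs. xs ! i) [0..<n]"
  have "recursive_on Or n (\<lambda>xs. ?p (map (\<lambda>f. f xs) ?Fs))"
  proof (rule recursive_on_comp)
    show "recursive_on Or (length ?Fs) ?p" using recursive.prim[OF f(1) g(1)] by (simp add: recursive_onI)
  qed (auto simp: H intro!: recursive_on_proj)
  then show ?thesis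
  proof (rule recursive_on_cong)
    fix xs :: "nat list" assume xs: "length xs = n"
    then have "map (\<lambda>f. f xs) ?Fs = H xs # xs" by (auto intro!: nth_equalityI)
    then show "?p (map (\<lambda>f. f xs) ?Fs) = rec_nat (F xs) (\<lambda>k r. G (k # r # xs)) (H xs)"
      using xs f(2) g(2) by (simp only: list.sel length_Cons)
  qed
qed

lemma recursive_on_Least:
  assumes F: "recursive_on Or (Suc n) F" and ex: "\<And>xs. length xs = n \<Longrightarrow> \<exists>k. F (k # xs) = 0"
  shows "recursive_on Or n (\<lambda>xs. LEAST k. F (k # xs) = 0)"
proof -
  obtain f where f: "recursive Or (Suc n) f" "\<And>xs. length xs = Suc n \<Longrightarrow> F xs = f xs"
    using F by (auto simp: recursive_on_def)
  have "recursive Or n (\<lambda>xs. LEAST k. f (k # xs) = 0)"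
  proof (rule recursive.mini[OF f(1)])
    fix xs :: "nat list" assume "length xs = n"
    then show "\<exists>k. f (k # xs) = 0" using ex[of xs] f(2) by simp
  qed
  then show ?thesis by (rule recursive_on_cong[OF recursive_onI]) (simp add: f(2))
qed

section \<open>Arithmetic and definition by cases\<close>

lemma recursive_on_add:
  assumes "recursive_on Or n F" "recursive_on Or n G"
  shows "recursive_on Or n (\<lambda>xs. F xs + G xs)"
proof -
  have "rec_nat a (\<lambda>k r. Suc r) b = a + b" for a b :: nat by (induction b) auto
  moreover have "recursive_on Or n (\<lambda>xs. rec_nat (F xs) (\<lambda>k r. Suc ((k # r # xs) ! 1)) (G xs))"
    using assms by (intro recursive_on_rec_nat recursive_on_Suc recursive_on_proj) auto
  ultimately show ?thesis by simp
qed

lemma recursive_on_pred: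
  assumes "recursive_on Or n F"
  shows "recursive_on Or n (\<lambda>xs. F xs - 1)"
proof -
  \<comment> \<open>The step discards the previous value and returns its counter; the start value 0
    agrees with truncated subtraction at 0.\<close>
  have "rec_nat 0 (\<lambda>k r. k) b = b - 1" for b :: nat by (induction b) auto
  moreover have "recursive_on Or n (\<lambda>xs. rec_nat 0 (\<lambda>k r. (k # r # xs) ! 0) (F xs))"
    using assms by (intro recursive_on_rec_nat recursive_on_const recursive_on_proj) auto
  ultimately show ?thesis by simp
qed

lemma recursive_on_diff:
  assumes "recursive_on Or n F" "recursive_on Or n G"
  shows "recursive_on Or n (\<lambda>xs. F xs - G xs)"
proof -
  have "rec_nat a (\<lambda>k r. r - 1) b = a - b" for a b :: nat by (induction b) auto
  moreover have "recursive_on Or n (\<lambda>xs. rec_nat (F xs) (\<lambda>k r. (k # r # xs) ! 1 - 1) (G xs))"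
    using assms by (intro recursive_on_rec_nat recursive_on_pred recursive_on_proj) auto
  ultimately show ?thesis by simp
qed

text \<open>A recursion of length \<open>C xs\<close> whose step always returns \<open>G xs\<close>:
  it leaves the start value \<open>F xs\<close> untouched only if the length is 0.\<close>

lemma recursive_on_if:
  assumes "recursive_on Or n C" "recursive_on Or n F" "recursive_on Or n G"
  shows "recursive_on Or n (\<lambda>xs. if C xs = 0 then F xs else G xs)"
proof -
  have "rec_nat a (\<lambda>k r. b) c = (if c = 0 then a else b)" for a b c :: nat by (cases c) auto
  moreover have "recursive_on Or (Suc (Suc n)) (\<lambda>xs. G (drop 2 xs))"
    using recursive_on_drop[OF assms(3), of 2] by simp
  then have "recursive_on Or n (\<lambda>xs. rec_nat (F xs) (\<lambda>k r. G (drop 2 (k # r # xs))) (C xs))"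
    using assms by (intro recursive_on_rec_nat)
  ultimately show ?thesis by simp
qed

section \<open>The Cantor pairing function and its inverse\<close>

lemma recursive_on_triangle:
  assumes "recursive_on Or n F"
  shows "recursive_on Or n (\<lambda>xs. triangle (F xs))"
proof -
  have "rec_nat 0 (\<lambda>k r. r + Suc k) b = triangle b" for b :: nat by (induction b) auto
  moreover have "recursive_on Or n (\<lambda>xs. rec_nat 0 (\<lambda>k r. (k # r # xs) ! 1 + Suc ((k # r # xs) ! 0)) (F xs))"
    using assms
    by (intro recursive_on_rec_nat recursive_on_add recursive_on_Suc recursive_on_const recursive_on_proj) auto
  ultimately show ?thesis by simp
qed

lemma recursive_on_prod_encode:
  assumes "recursive_on Or n F" "recursive_on Or n G"
  shows "recursive_on Or n (\<lambda>xs. prod_encode (F xs, G xs))"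
  unfolding prod_encode_def prod.case using assms
  by (intro recursive_on_add recursive_on_triangle)

text \<open>The index of the antidiagonal on which the pair coded by \<open>m\<close> lies, that is,
  the sum of its coordinates. The vanishing truncated difference expresses
  \<open>m < triangle (Suc w)\<close> in the form that minimization accepts.\<close>

definition diagonal_of :: "nat \<Rightarrow> nat" where
  "diagonal_of m = (LEAST w. Suc m - triangle (Suc w) = 0)"

text \<open>The code of \<open>(a, b)\<close> is \<open>triangle (a + b) + a\<close>, which lies at
  or above \<open>triangle (a + b)\<close> and below \<open>triangle (Suc (a + b))\<close>;
  monotonicity of \<open>triangle\<close> excludes smaller candidates.\<close>

lemma diagonal_of_prod_encode: "diagonal_of (prod_encode (a, b)) = a + b"
  unfolding diagonal_of_def
proof (rule Least_equality)
  fix w assume "Suc (prod_encode (a, b)) - triangle (Suc w) = 0"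
  then have w: "triangle (a + b) < triangle (Suc w)" by (simp add: prod_encode_def)
  have "mono triangle" by (rule mono_iff_le_Suc[THEN iffD2]) simp
  then have "\<not> Suc w \<le> a + b" using w by (meson monoD leD)
  then show "a + b \<le> w" by simp
qed (simp add: prod_encode_def)

text \<open>The offset of \<open>m\<close> along its diagonal is the first coordinate, and the
  coordinates add up to the index of the diagonal. This makes decoding recursive.\<close>

lemma prod_decode_diagonal:
  "fst (prod_decode m) = m - triangle (diagonal_of m)"
  "snd (prod_decode m) = diagonal_of m - (m - triangle (diagonal_of m))"
proof -
  obtain a b where "m = prod_encode (a, b)" by (metis prod_decode_inverse surj_pair)
  moreover from this have "diagonal_of m = a + b" by (simp add: diagonal_of_prod_encode)
  moreover have "prod_encode (a, b) - triangle (a + b) = a" by (simp add: prod_encode_def)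
  ultimately show "fst (prod_decode m) = m - triangle (diagonal_of m)"
    "snd (prod_decode m) = diagonal_of m - (m - triangle (diagonal_of m))" by simp_all
qed

lemma computable_fun_diagonal_of: "computable_fun Or diagonal_of"
proof -
  let ?F = "\<lambda>xs. Suc (xs ! 1) - triangle (Suc (xs ! 0))"
  have "recursive_on Or 1 (\<lambda>xs. LEAST k. ?F (k # xs) = 0)"
  proof (rule recursive_on_Least)
    show "recursive_on Or (Suc 1) ?F"
      by (intro recursive_on_diff recursive_on_Suc recursive_on_triangle recursive_on_proj) auto
    fix xs :: "nat list"
    \<comment> \<open>The search is regular because the argument itself is always a candidate:
      \<open>triangle (Suc m)\<close> is at least \<open>Suc m\<close>.\<close>
    have "?F (xs ! 0 # xs) = 0" by simp
    then show "\<exists>k. ?F (k # xs) = 0" by blast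
  qed
  then show ?thesis by (simp add: computable_fun_iff diagonal_of_def)
qed

lemma recursive_on_fst_prod_decode:
  assumes "recursive_on Or n F"
  shows "recursive_on Or n (\<lambda>xs. fst (prod_decode (F xs)))"
  unfolding prod_decode_diagonal using assms
  by (intro recursive_on_diff recursive_on_triangle
      recursive_on_computable[OF computable_fun_diagonal_of])

lemma recursive_on_snd_prod_decode:
  assumes "recursive_on Or n F"
  shows "recursive_on Or n (\<lambda>xs. snd (prod_decode (F xs)))"
  unfolding prod_decode_diagonal using assms
  by (intro recursive_on_diff recursive_on_triangle
      recursive_on_computable[OF computable_fun_diagonal_of])

lemmas recursive_on_intros =
  recursive_on_const recursive_on_Suc recursive_on_add recursive_on_diff recursive_on_if
  recursive_on_prod_encode recursive_on_fst_prod_decode recursive_on_snd_prod_decode recursive_on_proj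

section \<open>Closure properties of c.e. sets\<close>

text \<open>Passing from ranges to projections of decidable relations removes the special case of
  the empty set and reduces the closure properties below to recoding witnesses.\<close>

lemma ce_in_iff_projection:
  "ce_in Or S \<longleftrightarrow> (\<exists>c. computable_fun Or c \<and> S = {x. \<exists>y. c (prod_encode (x, y)) = 0})"
proof
  assume "ce_in Or S"
  then consider "S = {}" | f where "computable_fun Or f" "S = range f" by (auto simp: ce_in_def)
  then show "\<exists>c. computable_fun Or c \<and> S = {x. \<exists>y. c (prod_encode (x, y)) = 0}"
  proof cases
    case 1
    have "computable_fun Or (\<lambda>_. 1)" by (simp add: computable_fun_iff recursive_on_const)
    with 1 show ?thesis by (intro exI[of _ "\<lambda>_. 1"]) simp
  next
    case 2
    \<comment> \<open>A sum of both truncated differences vanishes exactly when they compare equal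
      numbers, so a witness for \<open>x\<close> is an argument at which \<open>f\<close> takes the
      value \<open>x\<close>.\<close>
    let ?c = "\<lambda>m. (f (snd (prod_decode m)) - fst (prod_decode m)) +
      (fst (prod_decode m) - f (snd (prod_decode m)))"
    have "computable_fun Or ?c"
      unfolding computable_fun_iff
      by (intro recursive_on_intros recursive_on_computable[OF 2(1)]) simp_all
    moreover have "S = {x. \<exists>y. ?c (prod_encode (x, y)) = 0}"
      by (auto simp: 2(2))
    ultimately show ?thesis by blast
  qed
next
  assume "\<exists>c. computable_fun Or c \<and> S = {x. \<exists>y. c (prod_encode (x, y)) = 0}"
  then obtain c where c: "computable_fun Or c" "S = {x. \<exists>y. c (prod_encode (x, y)) = 0}" by blast
  show "ce_in Or S"
  proof (cases "S = {}")
    case False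
    then obtain s where s: "s \<in> S" by blast
    \<comment> \<open>All pairs of a candidate and a witness are run through; a failing pair outputs
      the default \<open>s\<close>, which keeps \<open>?f\<close> total with values in
      \<open>S\<close>.\<close>
    let ?f = "\<lambda>m. if c m = 0 then fst (prod_decode m) else s"
    have "computable_fun Or ?f"
      unfolding computable_fun_iff
      by (intro recursive_on_intros recursive_on_computable[OF c(1)]) simp_all
    moreover have "S = range ?f"
    proof (intro equalityI subsetI)
      fix x assume "x \<in> S"
      then obtain y where "c (prod_encode (x, y)) = 0" using c(2) by blast
      then have "?f (prod_encode (x, y)) = x" by simp
      then show "x \<in> range ?f" by (intro range_eqI[OF sym])
    next
      fix x assume "x \<in> range ?f"
      then obtain m where m: "x = ?f m" by blast
      show "x \<in> S"
      proof (cases "c m = 0")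
        case True
        then have "c (prod_encode (x, snd (prod_decode m))) = 0" using m by simp
        then show ?thesis using c(2) by blast
      qed (use m s in auto)
    qed
    ultimately show ?thesis unfolding ce_in_def by blast
  qed (simp add: ce_in_def)
qed

lemma ce_in_vimage:
  assumes "ce_in Or S" "computable_fun Or p"
  shows "ce_in Or {x. p x \<in> S}"
proof -
  obtain c where c: "computable_fun Or c" "S = {x. \<exists>y. c (prod_encode (x, y)) = 0}"
    using assms(1) by (auto simp: ce_in_iff_projection)
  let ?c = "\<lambda>m. c (prod_encode (p (fst (prod_decode m)), snd (prod_decode m)))"
  have "computable_fun Or ?c"
    unfolding computable_fun_iff
    by (intro recursive_on_computable[OF c(1)] recursive_on_computable[OF assms(2)]
        recursive_on_intros) simp_all
  moreover have "{x. p x \<in> S} = {x. \<exists>y. ?c (prod_encode (x, y)) = 0}" using c(2) by simp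
  ultimately show ?thesis unfolding ce_in_iff_projection by blast
qed

text \<open>Membership in the two sets may need different witnesses, so one witness for the
  intersection codes a pair of them.\<close>

lemma ce_in_Int:
  assumes "ce_in Or S" "ce_in Or T"
  shows "ce_in Or (S \<inter> T)"
proof -
  obtain c where c: "computable_fun Or c" "S = {x. \<exists>y. c (prod_encode (x, y)) = 0}"
    using assms(1) by (auto simp: ce_in_iff_projection)
  obtain d where d: "computable_fun Or d" "T = {x. \<exists>y. d (prod_encode (x, y)) = 0}"
    using assms(2) by (auto simp: ce_in_iff_projection)
  let ?c = "\<lambda>m. c (prod_encode (fst (prod_decode m), fst (prod_decode (snd (prod_decode m))))) +
    d (prod_encode (fst (prod_decode m), snd (prod_decode (snd (prod_decode m)))))"
  have "computable_fun Or ?c"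
    unfolding computable_fun_iff
    by (intro recursive_on_add recursive_on_computable[OF c(1)] recursive_on_computable[OF d(1)]
        recursive_on_intros) simp_all
  moreover have "S \<inter> T = {x. \<exists>y. ?c (prod_encode (x, y)) = 0}"
  proof (intro equalityI subsetI)
    fix x assume "x \<in> S \<inter> T"
    then obtain y z where "c (prod_encode (x, y)) = 0" "d (prod_encode (x, z)) = 0"
      using c(2) d(2) by blast
    then have "?c (prod_encode (x, prod_encode (y, z))) = 0" by simp
    then show "x \<in> {x. \<exists>y. ?c (prod_encode (x, y)) = 0}" by blast
  qed (auto simp: c(2) d(2))
  ultimately show ?thesis unfolding ce_in_iff_projection by blast
qed

text \<open>The new quantifier merges with the one over witnesses by pairing.\<close>

lemma ce_in_Ex:
  assumes "ce_in Or S"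
  shows "ce_in Or {x. \<exists>z. prod_encode (x, z) \<in> S}"
proof -
  obtain c where c: "computable_fun Or c" "S = {x. \<exists>y. c (prod_encode (x, y)) = 0}"
    using assms by (auto simp: ce_in_iff_projection)
  let ?c = "\<lambda>m. c (prod_encode (prod_encode (fst (prod_decode m), fst (prod_decode (snd (prod_decode m)))),
    snd (prod_decode (snd (prod_decode m)))))"
  have "computable_fun Or ?c"
    unfolding computable_fun_iff
    by (intro recursive_on_computable[OF c(1)] recursive_on_intros) simp_all
  moreover have "{x. \<exists>z. prod_encode (x, z) \<in> S} = {x. \<exists>y. ?c (prod_encode (x, y)) = 0}"
  proof (intro equalityI subsetI)
    fix x assume "x \<in> {x. \<exists>z. prod_encode (x, z) \<in> S}"
    then obtain z y where "c (prod_encode (prod_encode (x, z), y)) = 0" using c(2) by blast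
    then have "?c (prod_encode (x, prod_encode (z, y))) = 0" by simp
    then show "x \<in> {x. \<exists>y. ?c (prod_encode (x, y)) = 0}" by blast
  qed (auto simp: c(2))
  ultimately show ?thesis unfolding ce_in_iff_projection by blast
qed

lemma recursive_oracle: "recursive {} n f \<Longrightarrow> recursive Or n f"
proof (induction rule: recursive.induct)
  case succ
  show ?case by (rule recursive.succ)
next
  case orac
  \<comment> \<open>A query to the empty oracle always answers 0, so it is replaced by a constant
    function.\<close>
  show ?case using recursive.zero by simp
qed (auto intro: recursive.intros)

lemma ce_imp_ce_in: "ce S \<Longrightarrow> ce_in Or S"
  unfolding ce_in_def computable_fun_def using recursive_oracle by blast

section \<open>Copies in the Hilbert cube\<close>

lemma KQ_subset_hcube: "K \<in> KQ \<Longrightarrow> K \<subseteq> hcube"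
  using compactin_subset_topspace[of Q_top K] by (simp add: KQ_def)

text \<open>Supplies the compact subpairs on which minimality is tested.\<close>

lemma KQ_Diff_rat_ball:
  assumes "K \<in> KQ"
  shows "K - rat_ball b \<in> KQ"
proof -
  have "openin Q_top (rat_ball b)" by (simp add: rat_ball_def split: prod.splits)
  then have "closedin Q_top (topspace Q_top - rat_ball b)" by blast
  then have "compactin Q_top (K \<inter> (topspace Q_top - rat_ball b))"
    using assms by (intro compact_Int_closedin) (auto simp: KQ_def)
  moreover have "K \<inter> (topspace Q_top - rat_ball b) = K - rat_ball b"
    using KQ_subset_hcube[OF assms] by auto
  ultimately show ?thesis by (simp add: KQ_def)
qed

lemma compact_pair_pair_in_Q:
  assumes "pair_in_Q X A"
  shows "compact_pair (subtopology Q_top X) A"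
  using assms hcube.metrizable_space_mtopology
  by (auto simp: compact_pair_def pair_in_Q_def KQ_def compact_space_subtopology
      metrizable_space_subtopology compactin_subtopology)

text \<open>The preimage of a subpair of a copy of \<open>(X, A)\<close> is itself a copy of that subpair.\<close>

lemma minimal_pair_copy:
  assumes inv: "topological_invariant P" and min: "minimal_pair P X A"
    and copy: "copy_in_Q (subtopology Q_top X) A Y B"
  shows "minimal_pair P Y B"
proof -
  have XA: "X \<in> KQ" "A \<in> KQ" "A \<subseteq> X" "(X, A) \<in> P" using min by (auto simp: minimal_pair_def pair_in_Q_def)
  have Xh: "X \<subseteq> hcube" using XA(1) by (rule KQ_subset_hcube)
  have Yh: "Y \<subseteq> hcube" using copy by (simp add: copy_in_Q_def)
  obtain h where h: "homeomorphic_map (subtopology Q_top X) (subtopology Q_top Y) h" "h ` A = B"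
    using copy by (auto simp: copy_in_Q_def)
  obtain g where hg: "homeomorphic_maps (subtopology Q_top X) (subtopology Q_top Y) h g"
    using h(1) by (auto simp: homeomorphic_map_maps)
  then have g: "homeomorphic_map (subtopology Q_top Y) (subtopology Q_top X) g"
    using homeomorphic_maps_map by blast
  have tX: "topspace (subtopology Q_top X) = X" and tY: "topspace (subtopology Q_top Y) = Y"
    using Xh Yh by auto
  have gh: "g (h x) = x" if "x \<in> X" for x using hg that tX by (auto simp: homeomorphic_maps_def)
  have hX: "h ` X = Y" using homeomorphic_imp_surjective_map[OF h(1)] tX tY by simp
  have gY: "g ` Y = X" using homeomorphic_imp_surjective_map[OF g] tX tY by simp
  have injg: "inj_on g Y" using homeomorphic_imp_injective_map[OF g] tY by simp
  have "g ` h ` A = (\<lambda>x. x) ` A"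
    unfolding image_image using gh XA(3) by (intro image_cong) auto
  then have gB: "g ` B = A" by (simp add: h(2))
  have BY: "B \<subseteq> Y" using h(2) hX XA(3) by blast
  \<comment> \<open>The map is continuous only between subspaces, whereas \<open>KQ\<close> refers
    to the whole cube; compactness of a subset does not depend on this choice.\<close>
  have image: "f ` K \<in> KQ"
    if "homeomorphic_map (subtopology Q_top S) (subtopology Q_top T) f" "K \<in> KQ" "K \<subseteq> S" for f S T K
  proof -
    have "compactin (subtopology Q_top S) K" using that by (simp add: compactin_subtopology KQ_def)
    then have "compactin (subtopology Q_top T) (f ` K)"
      using that(1) image_compactin homeomorphic_imp_continuous_map by blast
    then show ?thesis by (simp add: compactin_subtopology KQ_def)
  qed
  have "Y \<in> KQ" "B \<in> KQ" using image[OF h(1), of X] image[OF h(1), of A] XA hX h(2) by auto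
  then have YB: "pair_in_Q Y B" using BY by (simp add: pair_in_Q_def)
  have "(Y, B) \<in> P"
    using inv XA copy unfolding topological_invariant_def pair_in_Q_def by blast
  moreover have "(Y', B') \<notin> P" if sub: "proper_subpair Y' B' Y B" for Y' B'
  proof
    assume P': "(Y', B') \<in> P"
    have Y': "Y' \<in> KQ" "B' \<in> KQ" "B' \<subseteq> Y'" "Y' \<subset> Y" "B' \<subseteq> B"
      using sub by (auto simp: proper_subpair_def pair_in_Q_def)
    have "homeomorphic_map (subtopology (subtopology Q_top Y) Y')
        (subtopology (subtopology Q_top X) (g ` Y')) g"
      using g by (rule homeomorphic_map_subtopologies_alt) (use Y' tY injg in \<open>auto dest: inj_onD\<close>)
    moreover have "Y \<inter> Y' = Y'" "X \<inter> g ` Y' = g ` Y'" using Y' gY by auto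
    ultimately have "homeomorphic_map (subtopology Q_top Y') (subtopology Q_top (g ` Y')) g"
      by (simp add: subtopology_subtopology)
    moreover have "g ` Y' \<subseteq> hcube" using Y' gY Xh by blast
    ultimately have "copy_in_Q (subtopology Q_top Y') B' (g ` Y') (g ` B')"
      unfolding copy_in_Q_def by blast
    then have "(g ` Y', g ` B') \<in> P"
      using inv P' Y' unfolding topological_invariant_def pair_in_Q_def by blast
    \<comment> \<open>Properness survives because \<open>g\<close> is injective on \<open>Y\<close>
      and maps it onto \<open>X\<close>.\<close>
    moreover have "g ` Y' \<noteq> X"
      using injg Y'(4) gY inj_on_image_eq_iff[of g Y Y' Y] by blast
    then have "proper_subpair (g ` Y') (g ` B') X A"
      unfolding proper_subpair_def pair_in_Q_def
      using image[OF g, of Y'] image[OF g, of B'] Y' gY gB by blast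
    ultimately show False using min by (auto simp: minimal_pair_def)
  qed
  ultimately show ?thesis using YB by (simp add: minimal_pair_def)
qed

section \<open>Computability of minimal pairs\<close>

text \<open>\<open>Suc (prod_encode (b, u))\<close> is the list code of \<open>b\<close> prepended
  to the list coded by \<open>u\<close>. Adjoining a ball to a finite union is thus a computable
  operation on codes.\<close>

lemma rat_union_cons: "rat_union (Suc (prod_encode (b, u))) = rat_ball b \<union> rat_union u"
proof -
  have "list_decode (Suc (prod_encode (b, u))) = b # list_decode u" by simp
  then show ?thesis by (simp add: rat_union_def)
qed

lemma minimal_pair_computable_in:
  assumes Sig: "Sigma02 P" and min: "minimal_pair P Y B"
    and Y: "semicomputable_in Or Y" and B: "semicomputable_in Or B"
  shows "computable_in Or Y"
proof -
  have YB: "Y \<in> KQ" "B \<in> KQ" "B \<subseteq> Y" "(Y, B) \<in> P" using min by (auto simp: minimal_pair_def pair_in_Q_def)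
  obtain \<A> \<B> where AB: "uniformly_Pi01 \<A>" "uniformly_Pi01 \<B>" and P: "P = (\<Union>n. \<A> n - \<B> n)"
    using Sig by (auto simp: Sigma02_def)
  \<comment> \<open>This index is chosen non-uniformly: the enumeration built below contains it as a
    constant and never computes it.\<close>
  obtain n where n: "(Y, B) \<in> \<A> n" "(Y, B) \<notin> \<B> n" using YB(4) P by auto
  obtain E where E: "ce E" "\<And>n. KQ \<times> KQ - \<A> n =
      (\<Union>(u, v) \<in> {(u, v). prod_encode (n, prod_encode (u, v)) \<in> E}. basic_open u v)"
    using AB(1) unfolding uniformly_Pi01_def uniformly_Sigma01_def by blast
  obtain E' where E': "\<And>n. KQ \<times> KQ - \<B> n =
      (\<Union>(u, v) \<in> {(u, v). prod_encode (n, prod_encode (u, v)) \<in> E'}. basic_open u v)"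
    using AB(2) unfolding uniformly_Pi01_def uniformly_Sigma01_def by blast
  have "(Y, B) \<in> KQ \<times> KQ - \<B> n" using n(2) YB by simp
  then obtain u v where uv: "(Y, B) \<in> basic_open u v" "basic_open u v \<subseteq> KQ \<times> KQ - \<B> n"
    unfolding E' by blast
  have meets_iff: "rat_ball b \<inter> Y \<noteq> {} \<longleftrightarrow> (Y - rat_ball b, B - rat_ball b) \<notin> \<A> n" for b
  proof
    assume "rat_ball b \<inter> Y \<noteq> {}"
    then have "proper_subpair (Y - rat_ball b) (B - rat_ball b) Y B"
      using YB KQ_Diff_rat_ball by (auto simp: proper_subpair_def pair_in_Q_def)
    then have "(Y - rat_ball b, B - rat_ball b) \<notin> P" using min by (simp add: minimal_pair_def)
    \<comment> \<open>Basic open sets of the upper Vietoris topology are closed under passing to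
      smaller compact sets.\<close>
    moreover have "(Y - rat_ball b, B - rat_ball b) \<in> basic_open u v"
      using uv(1) KQ_Diff_rat_ball by (auto simp: basic_open_def)
    then have "(Y - rat_ball b, B - rat_ball b) \<notin> \<B> n" using uv(2) by blast
    ultimately show "(Y - rat_ball b, B - rat_ball b) \<notin> \<A> n" using P by blast
  next
    assume "(Y - rat_ball b, B - rat_ball b) \<notin> \<A> n"
    \<comment> \<open>By contraposition: a ball missing \<open>Y\<close> also misses
      \<open>B\<close>, so nothing is deleted and the pair remains in \<open>\<A> n\<close>.\<close>
    moreover have "Y - rat_ball b = Y" "B - rat_ball b = B" if "rat_ball b \<inter> Y = {}"
      using that YB(3) by auto
    ultimately show "rat_ball b \<inter> Y \<noteq> {}" using n(1) by fastforce
  qed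
  define SY where "SY = {l. Y \<subseteq> rat_union l}"
  define SB where "SB = {l. B \<subseteq> rat_union l}"
  have ce: "ce_in Or SY" "ce_in Or SB" "ce_in Or E"
    using Y B E(1) by (auto simp: semicomputable_in_def SY_def SB_def ce_imp_ce_in)
  have enum: "rat_ball b \<inter> Y \<noteq> {} \<longleftrightarrow> (\<exists>u v. prod_encode (n, prod_encode (u, v)) \<in> E \<and>
      Suc (prod_encode (b, u)) \<in> SY \<and> Suc (prod_encode (b, v)) \<in> SB)" for b
  proof -
    have "(Y - rat_ball b, B - rat_ball b) \<notin> \<A> n \<longleftrightarrow>
        (Y - rat_ball b, B - rat_ball b) \<in> KQ \<times> KQ - \<A> n"
      using YB KQ_Diff_rat_ball by auto
    also have "\<dots> \<longleftrightarrow> (\<exists>u v. prod_encode (n, prod_encode (u, v)) \<in> E \<and>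
        (Y - rat_ball b, B - rat_ball b) \<in> basic_open u v)"
      unfolding E(2) by blast
    also have "\<dots> \<longleftrightarrow> (\<exists>u v. prod_encode (n, prod_encode (u, v)) \<in> E \<and>
        Suc (prod_encode (b, u)) \<in> SY \<and> Suc (prod_encode (b, v)) \<in> SB)"
      \<comment> \<open>\<open>Diff_subset_conv\<close> moves the deleted ball to the right of the
        inclusion, where \<open>rat_union_cons\<close> absorbs it into the code; what remains are
        queries about \<open>Y\<close> and \<open>B\<close> themselves.\<close>
      using YB by (simp add: basic_open_def SY_def SB_def rat_union_cons KQ_Diff_rat_ball Diff_subset_conv)
    finally show ?thesis by (simp add: meets_iff)
  qed
  let ?b = "\<lambda>m. fst (prod_decode m)" and ?w = "\<lambda>m. snd (prod_decode m)"
  \<comment> \<open>Here \<open>m\<close> codes \<open>b\<close> together with a code of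
    \<open>(u, v)\<close>, so each of the three conditions is the preimage of a c.e. set under a
    computable map.\<close>
  define T where "T = {m. prod_encode (n, ?w m) \<in> E} \<inter> ({m. Suc (prod_encode (?b m, ?b (?w m))) \<in> SY} \<inter>
    {m. Suc (prod_encode (?b m, ?w (?w m))) \<in> SB})"
  have "ce_in Or T"
    unfolding T_def
    by (intro ce_in_Int ce_in_vimage ce; unfold computable_fun_iff; intro recursive_on_intros; simp)
  then have "ce_in Or {b. \<exists>w. prod_encode (b, w) \<in> T}" by (rule ce_in_Ex)
  moreover have "{b. \<exists>w. prod_encode (b, w) \<in> T} = {b. rat_ball b \<inter> Y \<noteq> {}}"
  proof (rule Collect_cong)
    fix b
    \<comment> \<open>Every number codes a pair, so the single witness \<open>w\<close> ranges over
      all choices of \<open>u\<close> and \<open>v\<close>.\<close>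
    have "(\<exists>w. prod_encode (b, w) \<in> T) \<longleftrightarrow> (\<exists>u v. prod_encode (b, prod_encode (u, v)) \<in> T)"
      by (metis prod_decode_inverse surj_pair)
    then show "(\<exists>w. prod_encode (b, w) \<in> T) \<longleftrightarrow> rat_ball b \<inter> Y \<noteq> {}"
      by (simp add: enum T_def)
  qed
  ultimately show ?thesis using Y by (simp add: computable_in_def)
qed

theorem theorem4p8:
  fixes P :: "(qset \<times> qset) set" and X A :: qset
  assumes "topological_invariant P"
    and "Sigma02 P"
    and "minimal_pair P X A"
  shows "strong_computable_type (subtopology Q_top X) A"
proof -
  have "pair_in_Q X A" using assms(3) by (simp add: minimal_pair_def)
  then have "compact_pair (subtopology Q_top X) A" by (rule compact_pair_pair_in_Q)
  then show ?thesis
    unfolding strong_computable_type_def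
    using minimal_pair_computable_in[OF assms(2) minimal_pair_copy[OF assms(1,3)]] by blast
qed

end
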